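(* Fix $h\in\mathbb C^\times$, let $U\subseteq\mathbb C$ be half-step-invariant, and let $X:U\to\mathbb C$ be an admissible map on $U$. Let $D,S:\mathcal P\to\mathcal P$ be the associated divided-difference and averaging operators, with transposes $\mathbf D,\mathbf S:\mathcal P'\to\mathcal P'$. Let $\mathbf u\in\mathcal P'$, let $\phi$ and $\psi$ be polynomials, and define $$L=\phi\,D^2+\psi\,SD.$$ Then the following hold. (i) If $\mathbf D(\phi\,\mathbf u)=\mathbf S(\psi\,\mathbf u)$ in $\mathcal P'$, then $\langle\mathbf u,(Lp)\,r\rangle=\langle\mathbf u,p\,(Lr)\rangle$ for every $p,r\in\mathcal P$. (ii) Assume, in addition, that $D(\mathcal P_{n+1})=\mathcal P_n$ for every $n\in\mathbb N$. If $\langle\mathbf u,(Lp)\,r\rangle=\langle\mathbf u,p\,(Lr)\rangle$ for every $p,r\in\mathcal P$, then $\mathbf D(\phi\,\mathbf u)=\mathbf S(\psi\,\mathbf u)$ in $\mathcal P'$. (iii) Let $N\in\mathbb N$, $N\ge1$, and assume that $D(\mathcal P_{n+1})=\mathcal P_n$ for $n=0,1,\dots,2N-1$. If $\langle\mathbf u,(Lp)\,r\rangle=\langle\mathbf u,p\,(Lr)\rangle$ for every $p\in\mathcal P$ and every $r\in\mathcal P_{2N}$, then $$\bigl\langle\mathbf D(\phi\,\mathbf u)-\mathbf S(\psi\,\mathbf u),\,v\bigr\rangle=0$$ for every $v\in\mathcal P_{2N-1}$. Moreover, for every function $f:U\to\mathbb C$ set $(\Delta f)(s)=f(s+h)-f(s)$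 and $(\nabla f)(s)=f(s)-f(s-h)$. Then, for every $p\in\mathcal P$ and every $s\in U$, $$(Lp)(X(s))=\phi(X(s))\,\frac1{Y(s)-Z(s)}\,\Delta\!\left(\frac{\nabla(p\circ X)}{X-Z_1}\right)(s)+\frac{\psi(X(s))}2\left(\frac{\Delta(p\circ X)(s)}{Y_1(s)-X(s)}+\frac{\nabla(p\circ X)(s)}{X(s)-Z_1(s)}\right)$$ (all denominators occurring here being non-zero).
   Context: $\mathbb N=\{0,1,2,\dots\}$, $\mathbb C^\times=\mathbb C\setminus\{0\}$. Fix $h\in\mathbb C^\times$. A non-empty set $U\subseteq\mathbb C$ is half-step-invariant if $U\pm\frac h2\subseteq U$. For $X:U\to\mathbb C$ put $Y(s)=X(s+\frac h2)$, $Z(s)=X(s-\frac h2)$, $Y_1(s)=X(s+h)$, $Z_1(s)=X(s-h)$. $X$ is parametrising if $Y-Z$ vanishes nowhere on $U$; it is admissible if moreover $X(U)$ is infinite and for every complex polynomial $p$ of degree $\ge1$ there is a polynomial $Q$ with $\deg Q\le\deg p-1$ and $\frac{p(Y)-p(Z)}{Y-Z}=Q(X)$ throughout $U$. $\mathcal P$ is the space of complex polynomials, the inductive limit of the finite-dimensional spaces $\mathcal P_n$ of polynomials of degree at most $n$; its continuous dual $\mathcal P'$ coincides with the space of all linear functionals on $\mathcal P$. For admissible $X$, $Dp$ and $Sp$ are the unique polynomials with $(Dp)(X)=\frac{p(Y)-p(Z)}{Y-Z}$ and $(Sp)(X)=\frac{p(Y)+p(Z)}2$ throughout $U$. On $\mathcal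 P'$: $\langle p_0\mathbf u,p\rangle=\langle\mathbf u,p_0p\rangle$, $\langle\mathbf D\mathbf u,p\rangle=-\langle\mathbf u,Dp\rangle$, $\langle\mathbf S\mathbf u,p\rangle=\langle\mathbf u,Sp\rangle$. *)

theory Defs
  imports Complex_Main "HOL-Computational_Algebra.Polynomial"
begin

text \<open>
  A map X : U -> C is represented by a total function of which only the values on U matter:
  every definition below evaluates X only at points of U, because a half-step-invariant set
  contains s + h/2, s - h/2, s + h and s - h along with s.
\<close>

definition half_step_invariant :: "complex \<Rightarrow> complex set \<Rightarrow> bool" where
  "half_step_invariant h U \<longleftrightarrow>
     U \<noteq> {} \<and> (\<forall>s\<in>U. s + h / 2 \<in> U) \<and> (\<forall>s\<in>U. s - h / 2 \<in> U)"

definition shY :: "complex \<Rightarrow> (complex \<Rightarrow> complex) \<Rightarrow> complex \<Rightarrow> complex" where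
  "shY h X s = X (s + h / 2)"

definition shZ :: "complex \<Rightarrow> (complex \<Rightarrow> complex) \<Rightarrow> complex \<Rightarrow> complex" where
  "shZ h X s = X (s - h / 2)"

definition shY1 :: "complex \<Rightarrow> (complex \<Rightarrow> complex) \<Rightarrow> complex \<Rightarrow> complex" where
  "shY1 h X s = X (s + h)"

definition shZ1 :: "complex \<Rightarrow> (complex \<Rightarrow> complex) \<Rightarrow> complex \<Rightarrow> complex" where
  "shZ1 h X s = X (s - h)"

definition parametrising :: "complex \<Rightarrow> complex set \<Rightarrow> (complex \<Rightarrow> complex) \<Rightarrow> bool" where
  "parametrising h U X \<longleftrightarrow> (\<forall>s\<in>U. shY h X s - shZ h X s \<noteq> 0)"

definition admissible :: "complex \<Rightarrow> complex set \<Rightarrow> (complex \<Rightarrow> complex) \<Rightarrow> bool" where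
  "admissible h U X \<longleftrightarrow>
     parametrising h U X \<and> infinite (X ` U) \<and>
     (\<forall>p :: complex poly. degree p \<ge> 1 \<longrightarrow>
       (\<exists>Q. degree Q \<le> degree p - 1 \<and>
         (\<forall>s\<in>U. (poly p (shY h X s) - poly p (shZ h X s)) / (shY h X s - shZ h X s)
                  = poly Q (X s))))"

definition Dop :: "complex \<Rightarrow> complex set \<Rightarrow> (complex \<Rightarrow> complex) \<Rightarrow> complex poly \<Rightarrow> complex poly"
  where
  "Dop h U X p = (THE q. \<forall>s\<in>U.
     poly q (X s) = (poly p (shY h X s) - poly p (shZ h X s)) / (shY h X s - shZ h X s))"

definition Sop :: "complex \<Rightarrow> complex set \<Rightarrow> (complex \<Rightarrow> complex) \<Rightarrow> complex poly \<Rightarrow> complex poly"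
  where
  "Sop h U X p = (THE q. \<forall>s\<in>U.
     poly q (X s) = (poly p (shY h X s) + poly p (shZ h X s)) / 2)"

definition polys_upto :: "nat \<Rightarrow> complex poly set" where
  "polys_upto n = {p. degree p \<le> n}"

text \<open>
  For the inductive-limit topology every linear functional on the space of polynomials is
  continuous, so the continuous dual is the full algebraic dual.
\<close>

definition polys_dual :: "(complex poly \<Rightarrow> complex) set" where
  "polys_dual = {u. Vector_Spaces.linear smult (*) u}"

definition fmult :: "complex poly \<Rightarrow> (complex poly \<Rightarrow> complex) \<Rightarrow> complex poly \<Rightarrow> complex" where
  "fmult p0 u p = u (p0 * p)"

definition Dtr :: "complex \<Rightarrow> complex set \<Rightarrow> (complex \<Rightarrow> complex)
    \<Rightarrow> (complex poly \<Rightarrow> complex) \<Rightarrow> complex poly \<Rightarrow> complex" where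
  "Dtr h U X u p = - u (Dop h U X p)"

definition Str :: "complex \<Rightarrow> complex set \<Rightarrow> (complex \<Rightarrow> complex)
    \<Rightarrow> (complex poly \<Rightarrow> complex) \<Rightarrow> complex poly \<Rightarrow> complex" where
  "Str h U X u p = u (Sop h U X p)"

definition Lop :: "complex \<Rightarrow> complex set \<Rightarrow> (complex \<Rightarrow> complex)
    \<Rightarrow> complex poly \<Rightarrow> complex poly \<Rightarrow> complex poly \<Rightarrow> complex poly" where
  "Lop h U X \<phi> \<psi> p =
     \<phi> * Dop h U X (Dop h U X p) + \<psi> * Sop h U X (Dop h U X p)"

definition fwd_diff :: "complex \<Rightarrow> (complex \<Rightarrow> complex) \<Rightarrow> complex \<Rightarrow> complex" where
  "fwd_diff h f s = f (s + h) - f s"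

definition bwd_diff :: "complex \<Rightarrow> (complex \<Rightarrow> complex) \<Rightarrow> complex \<Rightarrow> complex" where
  "bwd_diff h f s = f s - f (s - h)"


text \<open>For an admissible map the two definite descriptions above are well defined.\<close>

lemma poly_eq_on_infinite:
  fixes q r :: "complex poly"
  assumes "infinite (X ` U)" and "\<And>s. s \<in> U \<Longrightarrow> poly q (X s) = poly r (X s)"
  shows "q = r"
proof (rule ccontr)
  assume "q \<noteq> r"
  then have "finite {x. poly (q - r) x = 0}"
    by (intro poly_roots_finite) simp
  moreover have "X ` U \<subseteq> {x. poly (q - r) x = 0}"
    using assms(2) by auto
  ultimately show False
    using assms(1) finite_subset by blast
qed

lemma admissible_D_exists:
  assumes "admissible h U X"
  shows "\<exists>q. \<forall>s\<in>U. poly q (X s)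
           = (poly p (shY h X s) - poly p (shZ h X s)) / (shY h X s - shZ h X s)"
proof (cases "degree p = 0")
  case True
  then obtain c where "p = [:c:]"
    using degree_eq_zeroE by blast
  then have "\<forall>s\<in>U. poly 0 (X s)
           = (poly p (shY h X s) - poly p (shZ h X s)) / (shY h X s - shZ h X s)"
    by simp
  then show ?thesis ..
next
  case False
  then have "degree p \<ge> 1" by simp
  then obtain Q where "\<forall>s\<in>U. (poly p (shY h X s) - poly p (shZ h X s)) / (shY h X s - shZ h X s)
      = poly Q (X s)"
    using assms unfolding admissible_def by blast
  then have "\<forall>s\<in>U. poly Q (X s)
      = (poly p (shY h X s) - poly p (shZ h X s)) / (shY h X s - shZ h X s)"
    by simp
  then show ?thesis ..
qed

lemma poly_Dop:
  assumes "admissible h U X" and "s \<in> U"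
  shows "poly (Dop h U X p) (X s)
           = (poly p (shY h X s) - poly p (shZ h X s)) / (shY h X s - shZ h X s)"
proof -
  have inf: "infinite (X ` U)"
    using assms(1) by (simp add: admissible_def)
  have "\<exists>!q. \<forall>s\<in>U. poly q (X s)
           = (poly p (shY h X s) - poly p (shZ h X s)) / (shY h X s - shZ h X s)"
    using admissible_D_exists[OF assms(1)] poly_eq_on_infinite[OF inf] by (metis (no_types, lifting))
  from theI'[OF this] assms(2) show ?thesis
    unfolding Dop_def by blast
qed

lemma Dop_unique:
  assumes "admissible h U X"
    and "\<And>s. s \<in> U \<Longrightarrow> poly q (X s)
           = (poly p (shY h X s) - poly p (shZ h X s)) / (shY h X s - shZ h X s)"
  shows "Dop h U X p = q"
  using assms by (intro poly_eq_on_infinite[of X U]) (simp_all add: poly_Dop admissible_def)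

text \<open>Existence of Sp follows from the product rule: Sp = D(x p) - (D(x^2) / 2) (Dp).\<close>

lemma admissible_S_exists:
  assumes "admissible h U X"
  shows "\<exists>q. \<forall>s\<in>U. poly q (X s) = (poly p (shY h X s) + poly p (shZ h X s)) / 2"
proof -
  let ?x = "[:0, 1:] :: complex poly"
  let ?q = "Dop h U X (?x * p) - smult (1 / 2) (Dop h U X (?x * ?x)) * Dop h U X p"
  have "poly ?q (X s) = (poly p (shY h X s) + poly p (shZ h X s)) / 2" if "s \<in> U" for s
  proof -
    have nz: "shY h X s - shZ h X s \<noteq> 0"
      using assms that by (simp add: admissible_def parametrising_def)
    have *: "(y * a - z * b) / (y - z) - 1 / 2 * ((y * y - z * z) / (y - z)) * ((a - b) / (y - z))
        = (a + b) / 2" if "y - z \<noteq> 0" for y z a b :: complex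
    proof -
      have e: "(y * y - z * z) / (y - z) = y + z"
        using that by (simp add: divide_eq_eq algebra_simps)
      have "(y * a - z * b) / (y - z) - 1 / 2 * (y + z) * ((a - b) / (y - z))
          = (y * a - z * b - 1 / 2 * (y + z) * (a - b)) / (y - z)"
        by (simp only: times_divide_eq_right diff_divide_distrib[symmetric])
      also have "y * a - z * b - 1 / 2 * (y + z) * (a - b) = (a + b) / 2 * (y - z)"
        by (simp add: field_simps)
      also have "(a + b) / 2 * (y - z) / (y - z) = (a + b) / 2"
        using that by (rule nonzero_mult_div_cancel_right)
      finally show ?thesis
        unfolding e .
    qed
    have "poly ?q (X s) = poly (Dop h U X (?x * p)) (X s)
        - 1 / 2 * poly (Dop h U X (?x * ?x)) (X s) * poly (Dop h U X p) (X s)"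
      by (simp only: poly_diff poly_mult poly_smult)
    also have "\<dots> = (poly p (shY h X s) + poly p (shZ h X s)) / 2"
      unfolding poly_Dop[OF assms that] poly_mult using *[OF nz] by (simp only: poly_pCons poly_0 mult_zero_right add_0_left add_0_right mult_1_right)
    finally show ?thesis .
  qed
  then show ?thesis by blast
qed

lemma poly_Sop:
  assumes "admissible h U X" and "s \<in> U"
  shows "poly (Sop h U X p) (X s) = (poly p (shY h X s) + poly p (shZ h X s)) / 2"
proof -
  have inf: "infinite (X ` U)"
    using assms(1) by (simp add: admissible_def)
  have "\<exists>!q. \<forall>s\<in>U. poly q (X s) = (poly p (shY h X s) + poly p (shZ h X s)) / 2"
    using admissible_S_exists[OF assms(1)] poly_eq_on_infinite[OF inf] by (metis (no_types, lifting))
  from theI'[OF this] assms(2) show ?thesis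
    unfolding Sop_def by blast
qed

lemma Sop_unique:
  assumes "admissible h U X"
    and "\<And>s. s \<in> U \<Longrightarrow> poly q (X s) = (poly p (shY h X s) + poly p (shZ h X s)) / 2"
  shows "Sop h U X p = q"
  using assms by (intro poly_eq_on_infinite[of X U]) (simp_all add: poly_Sop admissible_def)

end

(* The Lagrange identity for L: with the discrete Wronskian W = Dp Sr - Sp Dr one has
   (Lp) r - p (Lr) = \<phi> DW + \<psi> SW, since at each point W may be evaluated using r and p shifted
   by either half step: W(X) = (Dp)(X) r(Y) - p(Y) (Dr)(X) = (Dp)(X) r(Z) - p(Z) (Dr)(X).
   Hence u((Lp) r - p (Lr)) = - <D(\<phi> u) - S(\<psi> u), W>, which gives (i).
   For the converses take r = 1, when W = Dp runs through the range of D. *)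
theory Submission
  imports Defs
begin

lemma half_step_invariantD:
  assumes "half_step_invariant h U" "s \<in> U"
  shows "s + h / 2 \<in> U" "s - h / 2 \<in> U"
  using assms by (auto simp: half_step_invariant_def)

lemma half_steps:
  fixes s h :: complex
  shows "s + h / 2 + h / 2 = s + h" "s - h / 2 - h / 2 = s - h"
    "s + h / 2 - h / 2 = s" "s - h / 2 + h / 2 = s"
  by (simp_all add: field_simps)

lemma admissible_step_neq:
  assumes "admissible h U X" "s \<in> U"
  shows "X (s + h / 2) \<noteq> X (s - h / 2)"
  using assms by (auto simp: admissible_def parametrising_def shY_def shZ_def)

definition wronskian :: "complex \<Rightarrow> complex set \<Rightarrow> (complex \<Rightarrow> complex)
    \<Rightarrow> complex poly \<Rightarrow> complex poly \<Rightarrow> complex poly" where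
  "wronskian h U X p r = Dop h U X p * Sop h U X r - Sop h U X p * Dop h U X r"

text \<open>By definition the Wronskian at \<open>X s\<close> is the mean of the two right-hand
  sides, and these coincide: they differ by Dp (r(Y) - r(Z)) - (p(Y) - p(Z)) Dr, which
  vanishes.\<close>

lemma poly_wronskian:
  assumes "admissible h U X" "s \<in> U"
  shows "poly (wronskian h U X p r) (X s)
           = poly (Dop h U X p) (X s) * poly r (shY h X s) - poly p (shY h X s) * poly (Dop h U X r) (X s)"
    and "poly (wronskian h U X p r) (X s)
           = poly (Dop h U X p) (X s) * poly r (shZ h X s) - poly p (shZ h X s) * poly (Dop h U X r) (X s)"
proof -
  have "shY h X s - shZ h X s \<noteq> 0"
    using admissible_step_neq[OF assms] by (simp add: shY_def shZ_def)
  \<comment> \<open>Both sides equal (Dp)(Dr)(Y - Z) at \<open>X s\<close>.\<close>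
  then have "poly (Dop h U X p) (X s) * (poly r (shY h X s) - poly r (shZ h X s))
      = (poly p (shY h X s) - poly p (shZ h X s)) * poly (Dop h U X r) (X s)"
    by (simp add: poly_Dop[OF assms])
  then show "poly (wronskian h U X p r) (X s)
           = poly (Dop h U X p) (X s) * poly r (shY h X s) - poly p (shY h X s) * poly (Dop h U X r) (X s)"
    and "poly (wronskian h U X p r) (X s)
           = poly (Dop h U X p) (X s) * poly r (shZ h X s) - poly p (shZ h X s) * poly (Dop h U X r) (X s)"
    unfolding wronskian_def poly_diff poly_mult poly_Sop[OF assms]
    by (simp_all add: field_simps) algebra+
qed

context
  fixes h :: complex and U :: "complex set" and X :: "complex \<Rightarrow> complex"
  assumes inv: "half_step_invariant h U" and adm: "admissible h U X"
begin

text \<open>At s + h/2 the Z-form is chosen and at s - h/2 the Y-form, because both then evaluate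
  the undifferentiated p and r at the common point \<open>X s\<close>.\<close>

lemma poly_wronskian_shift:
  assumes "s \<in> U"
  shows "poly (wronskian h U X p r) (shY h X s)
           = poly (Dop h U X p) (shY h X s) * poly r (X s) - poly p (X s) * poly (Dop h U X r) (shY h X s)"
    and "poly (wronskian h U X p r) (shZ h X s)
           = poly (Dop h U X p) (shZ h X s) * poly r (X s) - poly p (X s) * poly (Dop h U X r) (shZ h X s)"
  using poly_wronskian(2)[OF adm half_step_invariantD(1)[OF inv assms]]
    poly_wronskian(1)[OF adm half_step_invariantD(2)[OF inv assms]]
  by (simp_all add: shY_def shZ_def half_steps)

text \<open>In the difference of the two shifted values, r(X) and p(X) are common factors, so only
  the increments of Dp and Dr remain and no mixed product-rule terms appear.
  \<open>Sop_wronskian\<close> is the same with half the sum.\<close>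

lemma Dop_wronskian:
  "Dop h U X (wronskian h U X p r)
     = Dop h U X (Dop h U X p) * r - p * Dop h U X (Dop h U X r)"
proof (rule Dop_unique[OF adm])
  fix s assume s: "s \<in> U"
  have "shY h X s - shZ h X s \<noteq> 0"
    using admissible_step_neq[OF adm s] by (simp add: shY_def shZ_def)
  then show "poly (Dop h U X (Dop h U X p) * r - p * Dop h U X (Dop h U X r)) (X s)
      = (poly (wronskian h U X p r) (shY h X s) - poly (wronskian h U X p r) (shZ h X s))
        / (shY h X s - shZ h X s)"
    unfolding poly_wronskian_shift[OF s] poly_diff poly_mult poly_Dop[OF adm s]
    by (simp add: divide_simps) (simp add: algebra_simps)
qed

lemma Sop_wronskian:
  "Sop h U X (wronskian h U X p r)
     = Sop h U X (Dop h U X p) * r - p * Sop h U X (Dop h U X r)"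
proof (rule Sop_unique[OF adm])
  fix s assume s: "s \<in> U"
  show "poly (Sop h U X (Dop h U X p) * r - p * Sop h U X (Dop h U X r)) (X s)
      = (poly (wronskian h U X p r) (shY h X s) + poly (wronskian h U X p r) (shZ h X s)) / 2"
    unfolding poly_wronskian_shift[OF s] poly_diff poly_mult poly_Sop[OF adm s]
    by (simp add: field_simps)
qed

lemma Lop_lagrange:
  "Lop h U X \<phi> \<psi> p * r - p * Lop h U X \<phi> \<psi> r
     = \<phi> * Dop h U X (wronskian h U X p r) + \<psi> * Sop h U X (wronskian h U X p r)"
  unfolding Lop_def Dop_wronskian Sop_wronskian by (simp add: algebra_simps)

lemma wronskian_one: "wronskian h U X p 1 = Dop h U X p"
proof -
  have "Dop h U X 1 = 0" "Sop h U X 1 = 1"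
    by (auto intro: Dop_unique[OF adm] Sop_unique[OF adm])
  then show ?thesis
    by (simp add: wronskian_def)
qed

text \<open>Applies u to \<open>Lop_lagrange\<close>; the minus sign on the \<open>Dtr\<close> term
  comes from the sign in the definition of the transpose of D.\<close>

lemma functional_lagrange:
  assumes "u \<in> polys_dual"
  shows "u (Lop h U X \<phi> \<psi> p * r) - u (p * Lop h U X \<phi> \<psi> r)
     = Str h U X (fmult \<psi> u) (wronskian h U X p r) - Dtr h U X (fmult \<phi> u) (wronskian h U X p r)"
proof -
  interpret u: Vector_Spaces.linear "smult :: complex \<Rightarrow> _" "(*)" u
    using assms by (simp add: polys_dual_def)
  show ?thesis
    by (simp add: Dtr_def Str_def fmult_def u.add u.diff[symmetric] Lop_lagrange)
qed

text \<open>Serves both converses: \<open>A\<close> and \<open>B\<close> stand for two consecutive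
  polynomial spaces, and a preimage p of v under D turns v into the Wronskian of p and 1.\<close>

lemma lagrange_symmetric_imp:
  assumes "u \<in> polys_dual" "Dop h U X ` A = B"
    and "\<And>p. u (Lop h U X \<phi> \<psi> p * 1) = u (p * Lop h U X \<phi> \<psi> 1)"
    and "v \<in> B"
  shows "Dtr h U X (fmult \<phi> u) v = Str h U X (fmult \<psi> u) v"
proof -
  obtain p where "v = Dop h U X p"
    using assms(2,4) by blast
  then show ?thesis
    using functional_lagrange[OF assms(1), of \<phi> \<psi> p 1] assms(3)[of p] by (simp add: wronskian_one)
qed

lemma step_neq:
  assumes "s \<in> U"
  shows "X (s + h) \<noteq> X s" "X s \<noteq> X (s - h)"
  using admissible_step_neq[OF adm half_step_invariantD(1)[OF inv assms]]
    admissible_step_neq[OF adm half_step_invariantD(2)[OF inv assms]]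
  by (simp_all add: half_steps)

text \<open>Recentring at s + h/2 or s - h/2 turns the central quotient of p into the forward or
  backward quotient at s.\<close>

lemma poly_Dop_shift:
  assumes "s \<in> U"
  shows "poly (Dop h U X p) (shY h X s) = (poly p (X (s + h)) - poly p (X s)) / (X (s + h) - X s)"
    and "poly (Dop h U X p) (shZ h X s) = (poly p (X s) - poly p (X (s - h))) / (X s - X (s - h))"
  using poly_Dop[OF adm half_step_invariantD(1)[OF inv assms], of p]
    poly_Dop[OF adm half_step_invariantD(2)[OF inv assms], of p]
  by (simp_all add: shY_def shZ_def half_steps)

text \<open>The backward quotient at s + h is the forward quotient at s, hence Dp at Y, while at s
  it is Dp at Z. So \<open>fwd_diff\<close> of it is the numerator of D(Dp), and the last bracket is
  twice S(Dp).\<close>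

lemma poly_Lop:
  assumes "s \<in> U"
  shows "poly (Lop h U X \<phi> \<psi> p) (X s) =
          poly \<phi> (X s) * (1 / (shY h X s - shZ h X s))
            * fwd_diff h (\<lambda>t. bwd_diff h (poly p \<circ> X) t / (X t - shZ1 h X t)) s
          + poly \<psi> (X s) / 2
            * (fwd_diff h (poly p \<circ> X) s / (shY1 h X s - X s)
               + bwd_diff h (poly p \<circ> X) s / (X s - shZ1 h X s))"
  by (simp add: Lop_def poly_Dop[OF adm assms] poly_Sop[OF adm assms] poly_Dop_shift[OF assms]
      fwd_diff_def bwd_diff_def shY1_def shZ1_def)

end

theorem theorem9p1:
  fixes h :: complex
    and U :: "complex set"
    and X :: "complex \<Rightarrow> complex"
    and u :: "complex poly \<Rightarrow> complex"
    and \<phi> \<psi> :: "complex poly"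
  assumes "h \<noteq> 0"
    and "half_step_invariant h U"
    and "admissible h U X"
    and "u \<in> polys_dual"
  shows
    "(Dtr h U X (fmult \<phi> u) = Str h U X (fmult \<psi> u) \<longrightarrow>
        (\<forall>p r. u (Lop h U X \<phi> \<psi> p * r) = u (p * Lop h U X \<phi> \<psi> r)))
   \<and> ((\<forall>n. Dop h U X ` polys_upto (n + 1) = polys_upto n) \<longrightarrow>
        (\<forall>p r. u (Lop h U X \<phi> \<psi> p * r) = u (p * Lop h U X \<phi> \<psi> r)) \<longrightarrow>
        Dtr h U X (fmult \<phi> u) = Str h U X (fmult \<psi> u))
   \<and> (\<forall>N::nat. N \<ge> 1 \<longrightarrow>
        (\<forall>n\<in>{0..2 * N - 1}. Dop h U X ` polys_upto (n + 1) = polys_upto n) \<longrightarrow>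
        (\<forall>p. \<forall>r\<in>polys_upto (2 * N). u (Lop h U X \<phi> \<psi> p * r) = u (p * Lop h U X \<phi> \<psi> r)) \<longrightarrow>
        (\<forall>v\<in>polys_upto (2 * N - 1).
           Dtr h U X (fmult \<phi> u) v - Str h U X (fmult \<psi> u) v = 0))
   \<and> (\<forall>s\<in>U. shY h X s - shZ h X s \<noteq> 0 \<and> shY1 h X s - X s \<noteq> 0 \<and> X s - shZ1 h X s \<noteq> 0
              \<and> X (s + h) - shZ1 h X (s + h) \<noteq> 0)
   \<and> (\<forall>p. \<forall>s\<in>U.
        poly (Lop h U X \<phi> \<psi> p) (X s) =
          poly \<phi> (X s) * (1 / (shY h X s - shZ h X s))
            * fwd_diff h (\<lambda>t. bwd_diff h (poly p \<circ> X) t / (X t - shZ1 h X t)) s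
          + poly \<psi> (X s) / 2
            * (fwd_diff h (poly p \<circ> X) s / (shY1 h X s - X s)
               + bwd_diff h (poly p \<circ> X) s / (X s - shZ1 h X s)))"
proof (intro conjI allI ballI impI)
  fix p r
  assume "Dtr h U X (fmult \<phi> u) = Str h U X (fmult \<psi> u)"
  then show "u (Lop h U X \<phi> \<psi> p * r) = u (p * Lop h U X \<phi> \<psi> r)"
    using functional_lagrange[OF assms(2-4), of \<phi> \<psi> p r] by simp
next
  assume D: "\<forall>n. Dop h U X ` polys_upto (n + 1) = polys_upto n"
    and sym: "\<forall>p r. u (Lop h U X \<phi> \<psi> p * r) = u (p * Lop h U X \<phi> \<psi> r)"
  show "Dtr h U X (fmult \<phi> u) = Str h U X (fmult \<psi> u)"
  proof
    fix v
    show "Dtr h U X (fmult \<phi> u) v = Str h U X (fmult \<psi> u) v"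
    proof (rule lagrange_symmetric_imp[OF assms(2-4)])
      \<comment> \<open>The level n varies with v: n = \<open>degree v\<close> is enough to contain
        v.\<close>
      show "Dop h U X ` polys_upto (degree v + 1) = polys_upto (degree v)"
        using D by blast
      show "u (Lop h U X \<phi> \<psi> p * 1) = u (p * Lop h U X \<phi> \<psi> 1)" for p
        using sym by blast
    qed (simp add: polys_upto_def)
  qed
next
  fix N :: nat and v
  assume D: "\<forall>n\<in>{0..2 * N - 1}. Dop h U X ` polys_upto (n + 1) = polys_upto n"
    and sym: "\<forall>p. \<forall>r\<in>polys_upto (2 * N). u (Lop h U X \<phi> \<psi> p * r) = u (p * Lop h U X \<phi> \<psi> r)"
    and v: "v \<in> polys_upto (2 * N - 1)"
  have one: "1 \<in> polys_upto (2 * N)"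
    by (simp add: polys_upto_def)
  have "Dtr h U X (fmult \<phi> u) v = Str h U X (fmult \<psi> u) v"
  proof (rule lagrange_symmetric_imp[OF assms(2-4) _ _ v])
    \<comment> \<open>This is the top index n = 2N - 1 of the assumed range, whose target space is
      exactly the one containing v.\<close>
    show "Dop h U X ` polys_upto (2 * N - 1 + 1) = polys_upto (2 * N - 1)"
      using D by auto
    show "u (Lop h U X \<phi> \<psi> p * 1) = u (p * Lop h U X \<phi> \<psi> 1)" for p
      using sym one by blast
  qed
  then show "Dtr h U X (fmult \<phi> u) v - Str h U X (fmult \<psi> u) v = 0"
    by simp
next
  fix s assume s: "s \<in> U"
  show "shY h X s - shZ h X s \<noteq> 0"
    using admissible_step_neq[OF assms(3) s] by (simp add: shY_def shZ_def)
  \<comment> \<open>The last denominator occurs because \<open>fwd_diff\<close> also evaluates the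
    backward quotient at s + h; it equals X(s + h) - X(s).\<close>
  show "shY1 h X s - X s \<noteq> 0" "X s - shZ1 h X s \<noteq> 0" "X (s + h) - shZ1 h X (s + h) \<noteq> 0"
    using step_neq[OF assms(2,3) s] by (simp_all add: shY1_def shZ1_def)
next
  fix p s assume "s \<in> U"
  then show "poly (Lop h U X \<phi> \<psi> p) (X s) =
          poly \<phi> (X s) * (1 / (shY h X s - shZ h X s))
            * fwd_diff h (\<lambda>t. bwd_diff h (poly p \<circ> X) t / (X t - shZ1 h X t)) s
          + poly \<psi> (X s) / 2
            * (fwd_diff h (poly p \<circ> X) s / (shY1 h X s - X s)
               + bwd_diff h (poly p \<circ> X) s / (X s - shZ1 h X s))"
    by (rule poly_Lop[OF assms(2,3)])
qed

end
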